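(* Let $H$ be a bipartite graph and $\alpha$ a $2$-edge-colouring with $(H,\alpha)$ complex-norming. Then for every $2$-edge-colouring $\beta$ of $H$ and every $f\in\mathcal{F}_{\mathbb{C}}$, $|t_{H,\beta}(f)|\le t_{H,\alpha}(f)$.
   Context: $\mathcal{F}_{\mathbb{C}}$ is the complex vector space of bounded measurable $f:[0,1]^2\to\mathbb{C}$. $H$ is finite, nonempty, without isolated vertices, with fixed bipartition $A\cup B$ and edges $(u,v)$, $u\in A$, $v\in B$. For $\gamma:E(H)\to\{0,1\}$, with variables $x_u$ ($u\in A$), $y_v$ ($v\in B$) in $[0,1]$ and Lebesgue measure, $t_{H,\gamma}(f)=\int\prod_{e=(u,v)\in E(H)}f(x_u,y_v)^{\gamma(e)}\overline{f(x_u,y_v)}^{1-\gamma(e)}$. $(H,\alpha)$ is complex-norming if $|t_{H,\alpha}(\cdot)|^{1/|E(H)|}$ is a seminorm on $\mathcal{F}_{\mathbb{C}}$ vanishing only on functions that are $0$ a.e. *)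

theory Defs
  imports "HOL-Analysis.Analysis"
begin

text \<open>A finite, nonempty bipartite graph without isolated vertices, with fixed bipartition
  \<open>A \<union> B\<close>; an edge is the ordered pair \<open>(u, v)\<close> with \<open>u \<in> A\<close> and \<open>v \<in> B\<close>.\<close>

definition bipartite_graph :: "'v set \<Rightarrow> 'v set \<Rightarrow> ('v \<times> 'v) set \<Rightarrow> bool" where
  "bipartite_graph A B E \<longleftrightarrow>
     finite A \<and> finite B \<and> A \<inter> B = {} \<and> A \<union> B \<noteq> {} \<and> E \<subseteq> A \<times> B \<and>
     (\<forall>u\<in>A. \<exists>v\<in>B. (u, v) \<in> E) \<and> (\<forall>v\<in>B. \<exists>u\<in>A. (u, v) \<in> E)"

definition edge_2colouring :: "('v \<times> 'v) set \<Rightarrow> ('v \<times> 'v \<Rightarrow> nat) \<Rightarrow> bool" where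
  "edge_2colouring E \<gamma> \<longleftrightarrow> \<gamma> \<in> E \<rightarrow> {0, 1}"

abbreviation unit_square :: "(real \<times> real) set" where
  "unit_square \<equiv> {0..1} \<times> {0..1}"

text \<open>Functions on the unit square are represented by total functions whose values outside
  the square are irrelevant: neither the conditions below nor the integrals see them.
  Measurability is Lebesgue measurability.\<close>

definition bounded_measurable :: "(real \<times> real \<Rightarrow> complex) set" where
  "bounded_measurable =
     {f. f \<in> borel_measurable (lebesgue_on unit_square) \<and> bounded (f ` unit_square)}"

text \<open>Since \<open>A\<close> and \<open>B\<close> are disjoint, the variables \<open>x\<^sub>u\<close> and \<open>y\<^sub>v\<close> are collected in
  one family \<open>z\<close> indexed by \<open>A \<union> B\<close>. The product measure has to be completed: if \<open>f\<close> is only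
  Lebesgue measurable, then \<open>z \<mapsto> f (z u, z v)\<close> need not be measurable for the product
  sigma-algebra, and the Bochner integral of a nonmeasurable function is \<open>0\<close> by convention.\<close>

definition unit_cube_measure :: "'v set \<Rightarrow> ('v \<Rightarrow> real) measure" where
  "unit_cube_measure V = completion (\<Pi>\<^sub>M w\<in>V. restrict_space lborel {0..1})"

definition hom_integral ::
  "'v set \<Rightarrow> 'v set \<Rightarrow> ('v \<times> 'v) set \<Rightarrow> ('v \<times> 'v \<Rightarrow> nat) \<Rightarrow> (real \<times> real \<Rightarrow> complex) \<Rightarrow> complex"
where
  "hom_integral A B E \<gamma> f =
     (LINT z | unit_cube_measure (A \<union> B).
        (\<Prod>(u, v)\<in>E. f (z u, z v) ^ \<gamma> (u, v) * cnj (f (z u, z v)) ^ (1 - \<gamma> (u, v))))"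

definition seminorm_on_bounded_measurable :: "((real \<times> real \<Rightarrow> complex) \<Rightarrow> real) \<Rightarrow> bool" where
  "seminorm_on_bounded_measurable N \<longleftrightarrow>
     (\<forall>f\<in>bounded_measurable. 0 \<le> N f) \<and>
     (\<forall>f\<in>bounded_measurable. \<forall>c. N (\<lambda>p. c * f p) = cmod c * N f) \<and>
     (\<forall>f\<in>bounded_measurable. \<forall>g\<in>bounded_measurable. N (\<lambda>p. f p + g p) \<le> N f + N g)"

definition complex_norming ::
  "'v set \<Rightarrow> 'v set \<Rightarrow> ('v \<times> 'v) set \<Rightarrow> ('v \<times> 'v \<Rightarrow> nat) \<Rightarrow> bool"
where
  "complex_norming A B E \<alpha> \<longleftrightarrow>
     (let N = (\<lambda>f. cmod (hom_integral A B E \<alpha> f) powr (1 / real (card E)))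
      in seminorm_on_bounded_measurable N \<and>
         (\<forall>f\<in>bounded_measurable. N f = 0 \<longrightarrow> (AE p in lebesgue_on unit_square. f p = 0)))"

end

theory Submission
  imports Defs "HOL-Computational_Algebra.Fundamental_Theorem_Algebra"
begin

text \<open>On step functions the integral is, up to normalisation, a finite sum \<open>T M\<close> over a matrix
  \<open>M\<close> that is multiplicative under Kronecker products. Expanding \<open>T\<close> of
  \<open>M\<^sup>\<otimes>\<^sup>N + cnj M\<^sup>\<otimes>\<^sup>N\<close> gives the sum of the \<open>N\<close>-th powers of the values of \<open>M\<close> under all
  colourings, and the triangle inequality bounds it by a constant times \<open>\<bar>T M\<bar>\<^sup>N\<close>; so no single
  value exceeds \<open>\<bar>T M\<bar>\<close>. That \<open>T M\<close> is nonnegative follows from definiteness by a continuity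
  argument for the complex argument of \<open>T\<close>. Both conclusions are closed conditions, and every
  bounded measurable function is a bounded a.e. limit of continuous functions, these in turn of
  step functions.\<close>

section \<open>Homomorphism sums of matrices\<close>

text \<open>Divide by an element \<open>a m\<close> of largest modulus and sum the generating series
  at \<open>r < 1\<close>. Every term \<open>1 / (1 - w t)\<close> has nonnegative real part, so the
  term \<open>1 / (1 - r)\<close> of \<open>m\<close> cannot be cancelled; if
  \<open>R < cmod (a m)\<close>, the assumed bound keeps the total bounded as \<open>r\<close> tends
  to 1.\<close>

lemma power_sum_bound:
  fixes a :: "'s \<Rightarrow> complex"
  assumes fin: "finite S" and s: "s \<in> S" and R: "0 \<le> R"
    and bound: "\<And>N. cmod (\<Sum>t\<in>S. a t ^ N) \<le> C * R ^ N"
  shows "cmod (a s) \<le> R"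
proof (rule ccontr)
  assume less: "\<not> cmod (a s) \<le> R"
  have "Max ((\<lambda>t. cmod (a t)) ` S) \<in> (\<lambda>t. cmod (a t)) ` S"
    using fin s by (intro Max_in) auto
  then obtain m where m: "m \<in> S" "cmod (a m) = Max ((\<lambda>t. cmod (a t)) ` S)"
    by auto
  have max: "cmod (a t) \<le> cmod (a m)" if "t \<in> S" for t
    unfolding m(2) using fin that by (intro Max_ge) auto
  have A: "R < cmod (a m)"
    using max[OF s] less by linarith
  define q where "q = R / cmod (a m)"
  have q: "0 \<le> q" "q < 1"
    using A R by (auto simp: q_def divide_simps)
  \<comment> \<open>The value of the geometric series with terms \<open>C * q ^ N\<close>, a bound
    free of \<open>r\<close>.\<close>
  define D where "D = C / (1 - q)"
  have le: "1 / (1 - r) \<le> D" if r: "0 < r" "r < 1" for r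
  proof -
    define w where "w t = of_real r * a t / a m" for t
    have w_norm: "cmod (w t) < 1" if "t \<in> S" for t
    proof -
      have "cmod (w t) = r * (cmod (a t) / cmod (a m))"
        using r by (simp add: w_def norm_mult norm_divide)
      also have "\<dots> \<le> r * 1"
        using r max[OF that] A R by (intro mult_left_mono) (auto simp: divide_simps)
      finally show ?thesis using r by simp
    qed
    have sums: "(\<lambda>N. \<Sum>t\<in>S. w t ^ N) sums (\<Sum>t\<in>S. 1 / (1 - w t))"
      by (intro sums_sum geometric_sums w_norm)
    have wN: "cmod (\<Sum>t\<in>S. w t ^ N) \<le> C * q ^ N" for N
    proof -
      have "(\<Sum>t\<in>S. w t ^ N) = (of_real r / a m) ^ N * (\<Sum>t\<in>S. a t ^ N)"
        by (simp add: w_def sum_distrib_left power_divide power_mult_distrib)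
      then have "cmod (\<Sum>t\<in>S. w t ^ N) = (r / cmod (a m)) ^ N * cmod (\<Sum>t\<in>S. a t ^ N)"
        using r by (simp add: norm_mult norm_power norm_divide)
      also have "\<dots> \<le> (1 / cmod (a m)) ^ N * (C * R ^ N)"
        using r by (intro mult_mono power_mono bound divide_right_mono) auto
      finally show ?thesis by (simp add: q_def power_divide)
    qed
    have qsums: "(\<lambda>N. C * q ^ N) sums D"
      using sums_mult[OF geometric_sums[of q], of C] q by (simp add: D_def)
    have "cmod (\<Sum>t\<in>S. 1 / (1 - w t)) \<le> D"
      using norm_suminf_le[OF wN sums_summable[OF qsums]] sums qsums by (simp add: sums_iff)
    moreover have "1 / (1 - r) \<le> Re (\<Sum>t\<in>S. 1 / (1 - w t))"
    proof -
      have Re_nonneg: "0 \<le> Re (1 / (1 - w t))" if "t \<in> S" for t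
        using complex_Re_le_cmod[of "w t"] w_norm[OF that] by (simp add: Re_divide)
      have "a m \<noteq> 0" using A R by auto
      then have "Re (1 / (1 - w m)) = 1 / (1 - r)"
        using r by (simp add: w_def Re_divide power2_eq_square)
      moreover have "Re (1 / (1 - w m)) \<le> (\<Sum>t\<in>S. Re (1 / (1 - w t)))"
        using Re_nonneg m(1) fin by (intro member_le_sum) auto
      ultimately show ?thesis by simp
    qed
    ultimately show ?thesis
      using complex_Re_le_cmod[of "\<Sum>t\<in>S. 1 / (1 - w t)"] by linarith
  qed
  \<comment> \<open>With \<open>r = 1 - 1 / d\<close> the left side of \<open>le\<close> is
    \<open>d\<close>, which exceeds \<open>D\<close>; \<open>2 \<le> d\<close> keeps
    \<open>r\<close> positive.\<close>
  define d where "d = \<bar>D\<bar> + 2"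
  have "2 \<le> d" "D < d" by (auto simp: d_def)
  moreover from this have "1 / (1 - (1 - 1 / d)) \<le> D"
    by (intro le) (auto simp: divide_simps)
  ultimately show False by auto
qed

lemma root_power:
  fixes x :: real
  assumes "0 \<le> x" "0 < k"
  shows "(x powr (1 / real k)) ^ k = x"
  using assms by (cases "x = 0") (simp_all add: powr_powr flip: powr_realpow)


section \<open>Multiplicativity of homomorphism sums under Kronecker products\<close>

definition conj_unless :: "nat \<Rightarrow> complex \<Rightarrow> complex" where
  "conj_unless c z = z ^ c * cnj z ^ (1 - c)"

lemma conj_unless_simps [simp]:
  "conj_unless 0 z = cnj z" "conj_unless (Suc 0) z = z" "conj_unless c 1 = 1"
  by (simp_all add: conj_unless_def)

lemma conj_unless_mult: "conj_unless c (x * y) = conj_unless c x * conj_unless c y"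
  by (simp add: conj_unless_def power_mult_distrib)

lemma cnj_conj_unless: "cnj (conj_unless c x) = conj_unless c (cnj x)"
  by (simp add: conj_unless_def)

text \<open>Colour 1 is the identity and colour 0 is conjugation; truncated subtraction makes any
  larger colour a power, which is not additive.\<close>

lemma conj_unless_add:
  "c \<in> {0, 1} \<Longrightarrow> conj_unless c (x + y) = conj_unless c x + conj_unless c y"
  by auto

text \<open>The matrix may depend on the edge, so that one sum covers every colouring and also
  families mixing a matrix with its conjugate.\<close>

definition hom_sum ::
  "'v set \<Rightarrow> ('v \<times> 'v) set \<Rightarrow> nat \<Rightarrow> ('v \<times> 'v \<Rightarrow> nat \<Rightarrow> nat \<Rightarrow> complex) \<Rightarrow> complex" where
  "hom_sum V E n F = (\<Sum>k\<in>V \<rightarrow>\<^sub>E {..<n}. \<Prod>e\<in>E. F e (k (fst e)) (k (snd e)))"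

lemma hom_sum_cong:
  assumes "E \<subseteq> V \<times> V"
    and "\<And>e i j. e \<in> E \<Longrightarrow> i < n \<Longrightarrow> j < n \<Longrightarrow> F e i j = G e i j"
  shows "hom_sum V E n F = hom_sum V E n G"
  unfolding hom_sum_def
proof (intro sum.cong prod.cong refl)
  fix k e assume "k \<in> V \<rightarrow>\<^sub>E {..<n}" "e \<in> E"
  moreover from this have "fst e \<in> V" "snd e \<in> V" using assms(1) by auto
  ultimately show "F e (k (fst e)) (k (snd e)) = G e (k (fst e)) (k (snd e))"
    by (intro assms(2)) (auto simp: PiE_iff)
qed

text \<open>A pair of indices is coded as one number by quotient and remainder; \<open>n\<close> is
  the size of the second factor.\<close>

definition kron ::
  "nat \<Rightarrow> (nat \<Rightarrow> nat \<Rightarrow> complex) \<Rightarrow> (nat \<Rightarrow> nat \<Rightarrow> complex) \<Rightarrow> nat \<Rightarrow> nat \<Rightarrow> complex" where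
  "kron n F G i j = F (i div n) (j div n) * G (i mod n) (j mod n)"

primrec kron_power ::
  "nat \<Rightarrow> nat \<Rightarrow> (nat \<Rightarrow> nat \<Rightarrow> complex) \<Rightarrow> nat \<Rightarrow> nat \<Rightarrow> complex" where
  "kron_power n 0 F = (\<lambda>i j. 1)"
| "kron_power n (Suc N) F = kron n (kron_power n N F) F"

lemma mult_add_less: "a < m \<Longrightarrow> b < n \<Longrightarrow> a * n + b < m * (n::nat)"
proof -
  assume "a < m" "b < n"
  then have "a * n + b < (a + 1) * n" "(a + 1) * n \<le> m * n"
    using mult_le_mono1[of "a + 1" m n] by auto
  then show ?thesis by linarith
qed

text \<open>Quotient and remainder by \<open>n\<close> turn a map into \<open>{..<m * n}\<close>
  into a pair of maps into \<open>{..<m}\<close> and \<open>{..<n}\<close>, and the product over the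
  edges splits accordingly.\<close>

lemma hom_sum_kron:
  assumes sub: "E \<subseteq> V \<times> V" and n: "0 < n"
  shows "hom_sum V E (m * n) (\<lambda>e. kron n (F e) (G e)) = hom_sum V E m F * hom_sum V E n G"
proof -
  have V: "fst e \<in> V" "snd e \<in> V" if "e \<in> E" for e
    using sub that by auto
  have "hom_sum V E m F * hom_sum V E n G =
     (\<Sum>(a, b)\<in>(V \<rightarrow>\<^sub>E {..<m}) \<times> (V \<rightarrow>\<^sub>E {..<n}).
        (\<Prod>e\<in>E. F e (a (fst e)) (a (snd e))) * (\<Prod>e\<in>E. G e (b (fst e)) (b (snd e))))"
    unfolding hom_sum_def sum_product sum.cartesian_product ..
  also have "\<dots> = hom_sum V E (m * n) (\<lambda>e. kron n (F e) (G e))"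
    unfolding hom_sum_def
  proof (rule sum.reindex_bij_witness[where
        i = "\<lambda>k. (\<lambda>v\<in>V. k v div n, \<lambda>v\<in>V. k v mod n)" and j = "\<lambda>(a, b). \<lambda>v\<in>V. a v * n + b v"])
    fix p assume p: "p \<in> (V \<rightarrow>\<^sub>E {..<m}) \<times> (V \<rightarrow>\<^sub>E {..<n})"
    obtain a b where ab: "p = (a, b)" "a \<in> V \<rightarrow>\<^sub>E {..<m}" "b \<in> V \<rightarrow>\<^sub>E {..<n}"
      using p by auto
    have less: "b v < n" "a v < m" if "v \<in> V" for v
      using ab that by (auto simp: PiE_iff)
    have "(\<lambda>v\<in>V. (\<lambda>v\<in>V. a v * n + b v) v div n) = a"
         "(\<lambda>v\<in>V. (\<lambda>v\<in>V. a v * n + b v) v mod n) = b"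
      using ab less n by (auto simp: fun_eq_iff PiE_iff extensional_def)
    then show "(\<lambda>v\<in>V. (case p of (a, b) \<Rightarrow> \<lambda>v\<in>V. a v * n + b v) v div n,
           \<lambda>v\<in>V. (case p of (a, b) \<Rightarrow> \<lambda>v\<in>V. a v * n + b v) v mod n) = p"
      by (simp add: ab(1))
    show "(case p of (a, b) \<Rightarrow> \<lambda>v\<in>V. a v * n + b v) \<in> V \<rightarrow>\<^sub>E {..<m * n}"
      using less by (auto simp: ab(1) mult_add_less)
    show "(\<Prod>e\<in>E. kron n (F e) (G e) ((case p of (a, b) \<Rightarrow> \<lambda>v\<in>V. a v * n + b v) (fst e))
             ((case p of (a, b) \<Rightarrow> \<lambda>v\<in>V. a v * n + b v) (snd e))) =
          (case p of (a, b) \<Rightarrow> (\<Prod>e\<in>E. F e (a (fst e)) (a (snd e))) *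
             (\<Prod>e\<in>E. G e (b (fst e)) (b (snd e))))"
      using n less V by (auto simp: ab(1) kron_def simp flip: prod.distrib intro!: prod.cong)
  next
    fix k assume k: "k \<in> V \<rightarrow>\<^sub>E {..<m * n}"
    then show "(\<lambda>v\<in>V. k v div n, \<lambda>v\<in>V. k v mod n) \<in> (V \<rightarrow>\<^sub>E {..<m}) \<times> (V \<rightarrow>\<^sub>E {..<n})"
      using n by (auto simp: PiE_iff less_mult_imp_div_less)
    show "(case (\<lambda>v\<in>V. k v div n, \<lambda>v\<in>V. k v mod n) of (a, b) \<Rightarrow> \<lambda>v\<in>V. a v * n + b v) = k"
      using k by (auto simp: fun_eq_iff PiE_iff extensional_def)
  qed
  finally show ?thesis ..
qed

lemma hom_sum_kron_power:
  assumes sub: "E \<subseteq> V \<times> V" and n: "0 < n" and "finite V"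
  shows "hom_sum V E (n ^ N) (\<lambda>e. kron_power n N (F e)) = hom_sum V E n F ^ N"
proof (induction N)
  case 0
  have "V \<rightarrow>\<^sub>E {..<1::nat} = {\<lambda>v\<in>V. 0}"
    by (auto simp: PiE_iff fun_eq_iff extensional_def)
  then show ?case
    by (simp add: hom_sum_def)
next
  case (Suc N)
  then show ?case
    using hom_sum_kron[OF sub n, of "n ^ N" "\<lambda>e. kron_power n N (F e)" F]
    by (simp add: mult.commute)
qed

lemma conj_unless_kron_power:
  "conj_unless c (kron_power n N F i j) = kron_power n N (\<lambda>i j. conj_unless c (F i j)) i j"
  by (induction N arbitrary: i j) (auto simp: kron_def conj_unless_mult)

lemma cnj_kron_power: "cnj (kron_power n N F i j) = kron_power n N (\<lambda>i j. cnj (F i j)) i j"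
  using conj_unless_kron_power[of 0] by simp

text \<open>The discrete form of complex-norming. The triangle inequality and definiteness are
  assumed for all positive sizes \<open>n\<close> at once, because Kronecker powers change the size;
  the normalising power of \<open>n\<close> is left out since it cancels.\<close>

locale norming_sum =
  fixes V :: "'v set" and E :: "('v \<times> 'v) set" and \<alpha> :: "'v \<times> 'v \<Rightarrow> nat"
    and T :: "nat \<Rightarrow> (nat \<Rightarrow> nat \<Rightarrow> complex) \<Rightarrow> complex"
  defines "T n F \<equiv> hom_sum V E n (\<lambda>e i j. conj_unless (\<alpha> e) (F i j))"
  assumes finite_V: "finite V" and finite_E: "finite E" and E_sub: "E \<subseteq> V \<times> V"
    and E_nonempty: "E \<noteq> {}" and colouring: "edge_2colouring E \<alpha>"
    and triangle: "\<And>n F G. 0 < n \<Longrightarrow> cmod (T n (\<lambda>i j. F i j + G i j)) powr (1 / real (card E)) \<le>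
      cmod (T n F) powr (1 / real (card E)) + cmod (T n G) powr (1 / real (card E))"
    and definite: "\<And>n F i j. 0 < n \<Longrightarrow> T n F = 0 \<Longrightarrow> i < n \<Longrightarrow> j < n \<Longrightarrow> F i j = 0"
begin

section \<open>The recolouring inequality\<close>

lemma card_E: "0 < card E"
  using finite_E E_nonempty by (simp add: card_gt_0_iff)

lemma \<alpha>_cases: "e \<in> E \<Longrightarrow> \<alpha> e \<in> {0, 1}"
  using colouring by (auto simp: edge_2colouring_def)

lemma T_kron_power: "0 < n \<Longrightarrow> T (n ^ N) (kron_power n N F) = T n F ^ N"
  using hom_sum_kron_power[OF E_sub _ finite_V, of n N "\<lambda>e i j. conj_unless (\<alpha> e) (F i j)"]
  by (simp add: T_def conj_unless_kron_power)

lemma T_cnj: "T n (\<lambda>i j. cnj (F i j)) = cnj (T n F)"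
  by (simp add: T_def hom_sum_def cnj_conj_unless)

lemma T_add_le:
  assumes "0 < n"
  shows "cmod (T n (\<lambda>i j. F i j + G i j)) \<le>
    (cmod (T n F) powr (1 / real (card E)) + cmod (T n G) powr (1 / real (card E))) ^ card E"
proof -
  have "cmod (T n (\<lambda>i j. F i j + G i j)) =
      (cmod (T n (\<lambda>i j. F i j + G i j)) powr (1 / real (card E))) ^ card E"
    using card_E by (simp add: root_power)
  also have "\<dots> \<le> (cmod (T n F) powr (1 / real (card E)) + cmod (T n G) powr (1 / real (card E))) ^ card E"
    by (intro power_mono triangle assms) auto
  finally show ?thesis .
qed

text \<open>Conjugating the argument on an edge flips the colour there, so each edge set
  \<open>S\<close> yields one colouring: \<open>\<alpha>\<close> on \<open>S\<close> and its
  opposite elsewhere. The values \<open>a S\<close> are the summands when \<open>T\<close> of a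
  matrix plus its conjugate is expanded, and multiplicativity turns them into \<open>N\<close>-th
  powers for the Kronecker power.\<close>

lemma recolour_le:
  assumes \<beta>: "edge_2colouring E \<beta>" and n: "0 < n"
  shows "cmod (hom_sum V E n (\<lambda>e i j. conj_unless (\<beta> e) (M i j))) \<le> cmod (T n M)"
proof -
  define X where "X S e i j = conj_unless (\<alpha> e) (if e \<in> S then M i j else cnj (M i j))" for S e i j
  define a where "a S = hom_sum V E n (X S)" for S
  have a_power: "T (n ^ N) (\<lambda>i j. kron_power n N M i j + cnj (kron_power n N M i j)) = (\<Sum>S\<in>Pow E. a S ^ N)"
    for N
  proof -
    let ?K = "kron_power n N M"
    have *: "(\<Prod>e\<in>E. conj_unless (\<alpha> e) (?K (k (fst e)) (k (snd e)) + cnj (?K (k (fst e)) (k (snd e))))) =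
       (\<Sum>S\<in>Pow E. \<Prod>e\<in>E. kron_power n N (X S e) (k (fst e)) (k (snd e)))" for k
    proof -
      have "(\<Prod>e\<in>E. conj_unless (\<alpha> e) (?K (k (fst e)) (k (snd e)) + cnj (?K (k (fst e)) (k (snd e))))) =
         (\<Prod>e\<in>E. conj_unless (\<alpha> e) (?K (k (fst e)) (k (snd e))) +
            conj_unless (\<alpha> e) (cnj (?K (k (fst e)) (k (snd e)))))"
        by (intro prod.cong refl conj_unless_add \<alpha>_cases)
      also have "\<dots> = (\<Sum>S\<in>Pow E. (\<Prod>e\<in>S. conj_unless (\<alpha> e) (?K (k (fst e)) (k (snd e)))) *
            (\<Prod>e\<in>E - S. conj_unless (\<alpha> e) (cnj (?K (k (fst e)) (k (snd e))))))"
        using finite_E by (rule prod_add)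
      also have "\<dots> = (\<Sum>S\<in>Pow E. \<Prod>e\<in>E. kron_power n N (X S e) (k (fst e)) (k (snd e)))"
      proof (rule sum.cong[OF refl])
        fix S assume "S \<in> Pow E"
        then have S: "S \<subseteq> E" by auto
        have "(\<Prod>e\<in>E. kron_power n N (X S e) (k (fst e)) (k (snd e))) =
          (\<Prod>e\<in>E - S. kron_power n N (X S e) (k (fst e)) (k (snd e))) *
          (\<Prod>e\<in>S. kron_power n N (X S e) (k (fst e)) (k (snd e)))"
          by (rule prod.subset_diff[OF S finite_E])
        then show "(\<Prod>e\<in>S. conj_unless (\<alpha> e) (?K (k (fst e)) (k (snd e)))) *
            (\<Prod>e\<in>E - S. conj_unless (\<alpha> e) (cnj (?K (k (fst e)) (k (snd e))))) =
            (\<Prod>e\<in>E. kron_power n N (X S e) (k (fst e)) (k (snd e)))"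
          by (simp add: X_def[abs_def] conj_unless_kron_power cnj_kron_power mult.commute)
      qed
      finally show ?thesis .
    qed
    have "T (n ^ N) (\<lambda>i j. ?K i j + cnj (?K i j)) =
        (\<Sum>S\<in>Pow E. hom_sum V E (n ^ N) (\<lambda>e. kron_power n N (X S e)))"
      unfolding T_def hom_sum_def * by (rule sum.swap)
    then show ?thesis
      by (simp add: a_def hom_sum_kron_power[OF E_sub n finite_V])
  qed
  have bound: "cmod (\<Sum>S\<in>Pow E. a S ^ N) \<le> 2 ^ card E * cmod (T n M) ^ N" for N
  proof -
    let ?K = "kron_power n N M"
    \<comment> \<open>\<open>T\<close> has the same modulus at both summands, by
      \<open>T_cnj\<close>; the two equal roots add up and give the factor
      \<open>2 ^ card E\<close>, independent of \<open>N\<close>.\<close>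
    have "cmod (\<Sum>S\<in>Pow E. a S ^ N) \<le> (cmod (T (n ^ N) ?K) powr (1 / real (card E)) +
        cmod (T (n ^ N) (\<lambda>i j. cnj (?K i j))) powr (1 / real (card E))) ^ card E"
      unfolding a_power[symmetric] using n by (intro T_add_le) auto
    also have "\<dots> = (2 * (cmod (T n M) ^ N) powr (1 / real (card E))) ^ card E"
      by (simp add: T_cnj T_kron_power n norm_power)
    also have "\<dots> = 2 ^ card E * cmod (T n M) ^ N"
      using card_E by (simp add: power_mult_distrib root_power)
    finally show ?thesis .
  qed
  \<comment> \<open>On the other edges the two colours differ within \<open>{0, 1}\<close>, so
    \<open>\<beta>\<close> is \<open>\<alpha>\<close> flipped there.\<close>
  define S where "S = {e \<in> E. \<beta> e = \<alpha> e}"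
  have "cmod (a S) \<le> cmod (T n M)"
    by (rule power_sum_bound[OF _ _ _ bound]) (auto simp: S_def finite_E)
  moreover have "a S = hom_sum V E n (\<lambda>e i j. conj_unless (\<beta> e) (M i j))"
    unfolding a_def
  proof (rule hom_sum_cong[OF E_sub])
    fix e i j assume "e \<in> E"
    then show "X S e i j = conj_unless (\<beta> e) (M i j)"
      using \<alpha>_cases[of e] \<beta> by (force simp: X_def S_def edge_2colouring_def)
  qed
  ultimately show ?thesis by simp
qed

end

section \<open>Positivity\<close>

text \<open>The difference of two continuous logarithms takes values in the integer multiples of
  \<open>2 * pi * \<i>\<close>, a discrete set, so it is constant on a connected set.\<close>

lemma log_diff_const:
  fixes f g :: "'a::topological_space \<Rightarrow> complex"
  assumes S: "connected S" and cont: "continuous_on S f" "continuous_on S g"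
    and eq: "\<And>x. x \<in> S \<Longrightarrow> exp (f x) = exp (g x)" and xy: "x \<in> S" "y \<in> S"
  shows "f x - f y = g x - g y"
proof -
  have "(\<lambda>x. f x - g x) constant_on S"
  proof (rule continuous_discrete_range_constant[OF S])
    show "continuous_on S (\<lambda>x. f x - g x)"
      by (intro continuous_intros cont)
    fix x assume x: "x \<in> S"
    show "\<exists>e>0. \<forall>y. y \<in> S \<and> f y - g y \<noteq> f x - g x \<longrightarrow> e \<le> cmod (f y - g y - (f x - g x))"
    proof (intro exI conjI allI impI)
      \<comment> \<open>The gap \<open>e\<close> is still schematic here; the final
        \<open>show\<close> fixes it as \<open>2 * pi\<close>.\<close>
      fix y assume y: "y \<in> S \<and> f y - g y \<noteq> f x - g x"
      let ?d = "f y - g y - (f x - g x)"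
      have "exp ?d = 1"
        using eq[of x] eq[of y] x y by (simp add: exp_diff)
      then obtain n :: int where n: "Re ?d = 0" "Im ?d = of_int (2 * n) * pi"
        unfolding exp_eq_1 by blast
      moreover have "?d \<noteq> 0" using y by simp
      ultimately have "n \<noteq> 0" by (auto simp: complex_eq_iff)
      then have "1 \<le> \<bar>real_of_int n\<bar>" by linarith
      then have "2 * pi * 1 \<le> 2 * pi * \<bar>real_of_int n\<bar>" by (intro mult_left_mono) auto
      then have "2 * pi \<le> \<bar>Im ?d\<bar>" unfolding n(2) by (simp add: abs_mult mult_ac)
      then show "2 * pi \<le> cmod ?d" using abs_Im_le_cmod[of ?d] by linarith
    qed simp
  qed
  then have "f x - g x = f y - g y"
    using xy by (auto simp: constant_on_def)
  then show ?thesis by (simp add: algebra_simps)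
qed

text \<open>Each linear factor \<open>s - r\<close> turns by at most \<open>\<pi>\<close> along the segment.\<close>

lemma poly_logarithm:
  fixes p :: "complex poly"
  assumes "\<And>s. s \<in> {0..1} \<Longrightarrow> poly p (of_real s) \<noteq> 0"
  shows "\<exists>L. continuous_on {0..1::real} L \<and> (\<forall>s\<in>{0..1}. poly p (of_real s) = exp (L s)) \<and>
    \<bar>Im (L 1 - L 0)\<bar> \<le> pi * real (degree p)"
  using assms
proof (induction "degree p" arbitrary: p)
  case 0
  then obtain c where c: "p = [:c:]" by (metis degree_eq_zeroE)
  then have "c \<noteq> 0" using 0(2)[of 0] by auto
  then show ?case
    by (intro exI[of _ "\<lambda>_. Ln c"]) (auto simp: c)
next
  case (Suc d)
  then have "\<not> constant (poly p)" by (simp add: constant_degree)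
  then obtain r where r: "poly p r = 0" using fundamental_theorem_of_algebra by blast
  then obtain q where q: "p = [:- r, 1:] * q" by (metis dvdE poly_eq_0_iff_dvd)
  have "q \<noteq> 0" using Suc(2) q by auto
  have "degree p = degree [:- r, 1:] + degree q"
    unfolding q using \<open>q \<noteq> 0\<close> by (intro degree_mult_eq) auto
  then have deg: "degree p = Suc (degree q)" by simp
  have r_out: "r \<noteq> of_real s" if "s \<in> {0..1}" for s :: real
    using Suc(3)[OF that] r by auto
  have nz: "r \<noteq> 0" using r_out[of 0] by auto
  obtain L where L: "continuous_on {0..1::real} L" "\<And>s. s \<in> {0..1} \<Longrightarrow> poly q (of_real s) = exp (L s)"
    "\<bar>Im (L 1 - L 0)\<bar> \<le> pi * real (degree q)"
    using Suc(1)[of q] Suc(2,3) deg q by fastforce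
  \<comment> \<open>Write \<open>s - r\<close> as \<open>- r * l s\<close>. The segment
    \<open>l s\<close> starts at 1 and meets the nonpositive reals only if \<open>r\<close> is a
    point of \<open>[0, 1]\<close>, so \<open>Ln\<close> is continuous along it and starts at
    0.\<close>
  define l where "l s = 1 - of_real s / r" for s :: real
  have l: "l s \<notin> \<real>\<^sub>\<le>\<^sub>0" if s: "s \<in> {0..1}" for s
  proof
    assume "l s \<in> \<real>\<^sub>\<le>\<^sub>0"
    then obtain u where u: "u \<le> 0" "l s = of_real u"
      by (elim nonpos_Reals_cases) auto
    have "of_real s / r = of_real (1 - u)" using u(2) by (simp add: l_def algebra_simps)
    then have "of_real s = of_real (1 - u) * r" using nz by (simp add: divide_simps)
    moreover have "complex_of_real (1 - u) \<noteq> 0" using u(1) by (simp only: of_real_eq_0_iff)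
    ultimately have "r = of_real (s / (1 - u))" by (simp add: field_simps)
    moreover have "s / (1 - u) \<in> {0..1}" using s u(1) by (auto simp: divide_simps)
    ultimately show False using r_out by blast
  qed
  have l_nz: "l s \<noteq> 0" if "s \<in> {0..1}" for s
    using l[OF that] by auto
  show ?case
  proof (intro exI[of _ "\<lambda>s. Ln (l s) + Ln (- r) + L s"] conjI ballI)
    have "continuous_on {0..1} l"
      unfolding l_def[abs_def] using nz by (intro continuous_intros) auto
    then show "continuous_on {0..1} (\<lambda>s. Ln (l s) + Ln (- r) + L s)"
      using l L(1) by (intro continuous_intros) auto
    show "poly p (of_real s) = exp (Ln (l s) + Ln (- r) + L s)" if "s \<in> {0..1}" for s
      using l_nz[OF that] nz L(2)[OF that] by (simp add: exp_add q l_def field_simps)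
    have "\<bar>Im (Ln (l 1))\<bar> \<le> pi"
      using mpi_less_Im_Ln[OF l_nz, of 1] Im_Ln_le_pi[OF l_nz, of 1] by auto
    then show "\<bar>Im (Ln (l 1) + Ln (- r) + L 1 - (Ln (l 0) + Ln (- r) + L 0))\<bar> \<le> pi * real (degree p)"
      using L(3) unfolding deg by (simp add: l_def algebra_simps)
  qed
qed

text \<open>All base-\<open>n\<close> digits of the row index are \<open>i\<close>, and those of the
  column index \<open>j\<close>. The position serves every \<open>F\<close>, so an entry kept equal
  to 1 along a path of matrices stays 1 in the Kronecker powers.\<close>

lemma kron_power_entry:
  assumes "i < n" "j < n"
  shows "\<exists>i'<n ^ N. \<exists>j'<n ^ N. \<forall>F. kron_power n N F i' j' = F i j ^ N"
proof (induction N)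
  case (Suc N)
  then obtain i' j' where "i' < n ^ N" "j' < n ^ N" "\<And>F. kron_power n N F i' j' = F i j ^ N"
    by blast
  then show ?case
    using assms mult_add_less[of i' "n ^ N" i n] mult_add_less[of j' "n ^ N" j n]
    by (intro exI[of _ "i' * n + i"] conjI exI[of _ "j' * n + j"]) (auto simp: kron_def mult_ac)
qed auto

lemma continuous_on_kron_power:
  assumes "\<And>i j. continuous_on S (\<lambda>x. F x i j)"
  shows "continuous_on S (\<lambda>x. kron_power n N (F x) i j)"
  by (induction N arbitrary: i j) (auto simp: kron_def[abs_def] intro!: continuous_intros assms)

section \<open>The argument of \<open>T\<close> along segments of matrices\<close>

context norming_sum
begin

text \<open>Conjugation fixes the real number \<open>s\<close>, so each edge contributes a factor of
  degree at most one. The degree bound does not depend on the size \<open>n\<close>, which makes the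
  later bound on the change of argument uniform.\<close>

lemma T_segment:
  "\<exists>p. degree p \<le> card E \<and> (\<forall>s. T n (\<lambda>i j. 1 + of_real s * (F i j - 1)) = poly p (of_real s))"
proof (intro exI conjI allI)
  let ?q = "\<lambda>k e. [:1, conj_unless (\<alpha> e) (F (k (fst e)) (k (snd e))) - 1:]"
  let ?p = "\<Sum>k\<in>V \<rightarrow>\<^sub>E {..<n}. \<Prod>e\<in>E. ?q k e"
  have "degree (\<Prod>e\<in>E. ?q k e) \<le> card E" for k
  proof -
    have "degree (\<Prod>e\<in>E. ?q k e) \<le> sum (degree \<circ> ?q k) E"
      by (rule degree_prod_sum_le[OF finite_E])
    also have "\<dots> \<le> (\<Sum>e\<in>E. 1)" by (intro sum_mono) auto
    finally show ?thesis by simp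
  qed
  then show "degree ?p \<le> card E"
    using finite_V by (intro degree_sum_le finite_PiE) auto
  have "conj_unless (\<alpha> e) (1 + of_real s * (z - 1)) = 1 + of_real s * (conj_unless (\<alpha> e) z - 1)"
    if "e \<in> E" for e s z
    using \<alpha>_cases[OF that] by auto
  then show "T n (\<lambda>i j. 1 + of_real s * (F i j - 1)) = poly ?p (of_real s)" for s
    by (simp add: T_def hom_sum_def poly_sum poly_prod)
qed

lemma continuous_on_T:
  assumes "\<And>i j. continuous_on S (\<lambda>x. F x i j)"
  shows "continuous_on S (\<lambda>x. T n (F x))"
  unfolding T_def hom_sum_def conj_unless_def by (intro continuous_intros assms)

lemma T_one: "T n (\<lambda>i j. 1) = of_nat (n ^ card V)"
  using finite_V by (simp add: T_def hom_sum_def card_PiE)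

text \<open>Join the all-ones matrix to \<open>M\<close> by a segment. Along the \<open>N\<close>-th Kronecker power of the
  segment the argument of \<open>T\<close> changes \<open>N\<close> times as much. That path can be deformed within the
  matrices having a fixed entry \<open>1\<close>, on which \<open>T\<close> does not vanish, to the segment from the
  all-ones matrix to the Kronecker power of \<open>M\<close>, where \<open>T\<close> is a polynomial of degree at most
  \<open>card E\<close>. So the change of argument is bounded in \<open>N\<close>, hence zero.\<close>

lemma T_pos_if_entry_1:
  assumes ij: "i0 < n" "j0 < n" and M: "M i0 j0 = 1"
  shows "\<exists>x>0. T n M = of_real x"
proof -
  have n: "0 < n" using ij by auto
  define seg where "seg F s i j = 1 + of_real s * (F i j - 1)"
    for F :: "nat \<Rightarrow> nat \<Rightarrow> complex" and s :: real and i j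
  have seg_01: "seg F 0 = (\<lambda>i j. 1)" "seg F 1 = F" for F
    by (auto simp: seg_def fun_eq_iff)
  \<comment> \<open>The entry 1 stays 1 on the whole segment, so \<open>T\<close> does not vanish
    there by definiteness and \<open>poly_logarithm\<close> applies.\<close>
  have seg_log: "\<exists>L. continuous_on {0..1} L \<and> (\<forall>s\<in>{0..1}. T m (seg F s) = exp (L s)) \<and>
      \<bar>Im (L 1 - L 0)\<bar> \<le> pi * card E" if F: "i < m" "j < m" "F i j = 1" for m F i j
  proof -
    obtain p where p: "degree p \<le> card E" "\<And>s. T m (seg F s) = poly p (of_real s)"
      using T_segment unfolding seg_def by blast
    have "poly p (of_real s) \<noteq> 0" for s
      unfolding p(2)[symmetric] using definite[of m "seg F s" i j] F by (auto simp: seg_def)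
    then obtain L where L: "continuous_on {0..1} L" "\<forall>s\<in>{0..1}. poly p (of_real s) = exp (L s)"
      "\<bar>Im (L 1 - L 0)\<bar> \<le> pi * real (degree p)"
      using poly_logarithm[of p] by blast
    have "pi * real (degree p) \<le> pi * card E"
      using p(1) by (intro mult_left_mono) auto
    with L(3) have "\<bar>Im (L 1 - L 0)\<bar> \<le> pi * card E" by linarith
    with L(1,2) show ?thesis unfolding p(2) by blast
  qed
  obtain L where L: "continuous_on {0..1} L" "\<And>s. s \<in> {0..1} \<Longrightarrow> T n (seg M s) = exp (L s)"
    using seg_log[where m = n and F = M, OF ij M] by blast
  have bound: "real N * \<bar>Im (L 1 - L 0)\<bar> \<le> pi * card E" for N
  proof -
    obtain i j where ij': "i < n ^ N" "j < n ^ N" and entry: "\<And>F. kron_power n N F i j = F i0 j0 ^ N"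
      using kron_power_entry[OF ij] by blast
    let ?K = "kron_power n N"
    \<comment> \<open>A homotopy over the square: the bottom side is the Kronecker power of the
      segment, the top side the segment to the Kronecker power of \<open>M\<close>. The entry
      \<open>(i, j)\<close> is a combination of two ones with weights summing to 1, hence 1
      throughout.\<close>
    define G where "G p a b = of_real (1 - snd p) * ?K (seg M (fst p)) a b +
      of_real (snd p) * seg (?K M) (fst p) a b" for p :: "real \<times> real" and a b
    have G_nz: "T (n ^ N) (G p) \<noteq> 0" for p
      using definite[of "n ^ N" "G p" i j] ij' n by (auto simp: G_def entry seg_def M)
    let ?S = "{0..1::real} \<times> {0..1::real}"
    have contG: "continuous_on ?S (\<lambda>p. T (n ^ N) (G p))"
      unfolding G_def[abs_def] seg_def[abs_def]
      by (intro continuous_on_T continuous_intros continuous_on_kron_power)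
    \<comment> \<open>The square is contractible, so the nonvanishing function has a continuous
      logarithm on it.\<close>
    obtain g where g: "continuous_on ?S g" "\<And>p. p \<in> ?S \<Longrightarrow> T (n ^ N) (G p) = exp (g p)"
      using continuous_logarithm_on_contractible[OF contG] G_nz
      by (metis convex_imp_contractible convex_Times convex_real_interval(5))
    have conn: "connected {0..1::real}" by simp
    have g_comp: "continuous_on {0..1} (\<lambda>s. g (h s))"
      if "continuous_on {0..1} h" "h ` {0..1} \<subseteq> ?S" for h :: "real \<Rightarrow> _"
      using continuous_on_compose2[OF g(1) that] .
    obtain L' where L': "continuous_on {0..1} L'"
      "\<And>s. s \<in> {0..1} \<Longrightarrow> T (n ^ N) (seg (?K M) s) = exp (L' s)" "\<bar>Im (L' 1 - L' 0)\<bar> \<le> pi * card E"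
      using seg_log[where m = "n ^ N" and F = "?K M", OF ij'] by (auto simp: entry M)
    have G_0: "G (s, 0) = ?K (seg M s)" and G_1: "G (s, 1) = seg (?K M) s" for s
      by (auto simp: G_def fun_eq_iff)
    have K1: "?K (\<lambda>i j. 1) = (\<lambda>i j. 1)" for n
      by (induction N) (auto simp: fun_eq_iff kron_def)
    have G_l: "G (0, r) = (\<lambda>i j. 1)" and G_r: "G (1, r) = ?K M" for r
      by (auto simp: G_def fun_eq_iff seg_01 K1 algebra_simps simp flip: of_real_add)
    have eq_bot: "g (1, 0) - g (0, 0) = of_nat N * L 1 - of_nat N * L 0"
    proof (rule log_diff_const[OF conn])
      show "continuous_on {0..1} (\<lambda>s. g (s, 0))"
        by (rule g_comp) (auto intro!: continuous_intros)
      show "exp (g (s, 0)) = exp (of_nat N * L s)" if "s \<in> {0..1}" for s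
        using g(2)[of "(s, 0)"] L(2)[of s] that n by (simp add: G_0 T_kron_power exp_of_nat_mult)
    qed (auto intro!: continuous_intros L)
    have eq_top: "g (1, 1) - g (0, 1) = L' 1 - L' 0"
    proof (rule log_diff_const[OF conn])
      show "continuous_on {0..1} (\<lambda>s. g (s, 1))"
        by (rule g_comp) (auto intro!: continuous_intros)
      show "exp (g (s, 1)) = exp (L' s)" if "s \<in> {0..1}" for s
        using g(2)[of "(s, 1)"] L'(2)[of s] that by (simp add: G_1)
    qed (auto intro!: L')
    \<comment> \<open>Both vertical sides are constant paths, so \<open>g\<close> does not change
      along them and the changes along top and bottom agree.\<close>
    have eq_side: "g (s, 1) - g (s, 0) = 0 - 0" if "s = 0 \<or> s = 1" for s
    proof -
      have *: "g (s, 1) - g (s, 0) = g (s, 0) - g (s, 0)"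
      proof (rule log_diff_const[OF conn])
        show "continuous_on {0..1} (\<lambda>r. g (s, r))"
          using that by (intro g_comp) (auto intro!: continuous_intros)
        show "exp (g (s, r)) = exp (g (s, 0))" if "r \<in> {0..1}" for r
          using g(2)[of "(s, r)"] g(2)[of "(s, 0)"] that \<open>s = 0 \<or> s = 1\<close> by (auto simp: G_l G_r)
      qed auto
      then show ?thesis by simp
    qed
    have "of_nat N * (L 1 - L 0) = g (1, 0) - g (0, 0)"
      unfolding eq_bot by (simp add: right_diff_distrib)
    also have "\<dots> = g (1, 1) - g (0, 1)"
      using eq_side[of 0] eq_side[of 1] by simp
    finally have "of_nat N * (L 1 - L 0) = L' 1 - L' 0"
      unfolding eq_top .
    then have "Im (of_nat N * (L 1 - L 0)) = Im (L' 1 - L' 0)" by simp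
    then have "real N * Im (L 1 - L 0) = Im (L' 1 - L' 0)" by simp
    then show ?thesis using L'(3) by (metis abs_mult abs_of_nat)
  qed
  \<comment> \<open>A nonzero change would outgrow the fixed bound for large
    \<open>N\<close>.\<close>
  have "Im (L 1 - L 0) = 0"
  proof (rule ccontr)
    assume "Im (L 1 - L 0) \<noteq> 0"
    then obtain N :: nat where "pi * card E < real N * \<bar>Im (L 1 - L 0)\<bar>"
      using reals_Archimedean3[of "\<bar>Im (L 1 - L 0)\<bar>"] by auto
    then show False using bound[of N] by linarith
  qed
  then have "L 1 - L 0 = of_real (Re (L 1 - L 0))"
    by (simp add: complex_eq_iff)
  then have *: "exp (L 1 - L 0) = of_real (exp (Re (L 1 - L 0)))"
    by (metis exp_of_real)
  \<comment> \<open>The value at the all-ones matrix is a positive integer, and the quotient is the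
    exponential of a real number.\<close>
  have "T n M = T n (\<lambda>i j. 1) * exp (L 1 - L 0)"
    using L(2)[of 0] L(2)[of 1] by (simp add: seg_01 exp_diff)
  also have "\<dots> = of_real (real (n ^ card V) * exp (Re (L 1 - L 0)))"
    unfolding * T_one by simp
  finally show ?thesis
    using n by (intro exI[of _ "real (n ^ card V) * exp (Re (L 1 - L 0))"]) auto
qed

lemma T_scale: "T n (\<lambda>i j. c * F i j) = (\<Prod>e\<in>E. conj_unless (\<alpha> e) c) * T n F"
  by (simp add: T_def hom_sum_def conj_unless_mult prod.distrib sum_distrib_left)

text \<open>Dividing by a nonzero entry \<open>c\<close> reduces to a matrix with an entry 1; what
  remains is the positivity of the scalar factor that \<open>T_scale\<close> produces.\<close>

lemma T_nonneg:
  assumes n: "0 < n"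
  shows "\<exists>x\<ge>0. T n M = of_real x"
proof (cases "\<exists>i<n. \<exists>j<n. M i j \<noteq> 0")
  case False
  have "T n M = hom_sum V E n (\<lambda>e i j. conj_unless (\<alpha> e) 0)"
    unfolding T_def using False by (intro hom_sum_cong[OF E_sub]) auto
  also have "\<dots> = 0"
  proof -
    have "\<exists>e\<in>E. conj_unless (\<alpha> e) 0 = 0"
      using E_nonempty \<alpha>_cases by force
    then show ?thesis
      using finite_E by (simp add: hom_sum_def)
  qed
  finally show ?thesis by (intro exI[of _ 0]) auto
next
  case True
  then obtain i j where ij: "i < n" "j < n" "M i j \<noteq> 0" by blast
  define c where "c = M i j"
  have c: "c \<noteq> 0" using ij by (simp add: c_def)
  \<comment> \<open>A 2 by 2 test matrix with \<open>1 / c\<close> in one place and 1 elsewhere.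
    Both it and its multiple by \<open>c\<close> have an entry 1, so the scalar factor is a quotient
    of two positive values.\<close>
  define P where "P = (\<lambda>i j. if i = (0::nat) \<and> j = (0::nat) then 1 / c else (1::complex))"
  obtain x where x: "0 < x" "T 2 P = of_real x"
    using T_pos_if_entry_1[of 1 2 1 P] by (auto simp: P_def)
  obtain y where y: "0 < y" "T 2 (\<lambda>i j. c * P i j) = of_real y"
    using T_pos_if_entry_1[of 0 2 0 "\<lambda>i j. c * P i j"] c by (auto simp: P_def)
  obtain z where z: "0 < z" "T n (\<lambda>i j. M i j / c) = of_real z"
    using T_pos_if_entry_1[of i n j "\<lambda>i j. M i j / c"] ij c by (auto simp: c_def)
  have "(\<Prod>e\<in>E. conj_unless (\<alpha> e) c) = of_real (y / x)"
    using T_scale[of 2 c P] x y by (simp add: field_simps)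
  then have "T n M = of_real (y / x * z)"
    using T_scale[of n c "\<lambda>i j. M i j / c"] z c by simp
  then show ?thesis using x y z by (intro exI[of _ "y / x * z"]) auto
qed

end

section \<open>Step functions and passage to the limit\<close>

abbreviation unit_interval_measure :: "real measure" where
  "unit_interval_measure \<equiv> restrict_space lborel {0..1}"

lemma emeasure_unit_interval:
  "X \<in> sets borel \<Longrightarrow> X \<subseteq> {0..1} \<Longrightarrow> emeasure unit_interval_measure X = emeasure lborel X"
  by (intro emeasure_restrict_space) auto

lemma space_unit_interval: "space unit_interval_measure = {0..1}"
  by (simp add: space_restrict_space)

lemma emeasure_space_unit_interval: "emeasure unit_interval_measure {0..1} = 1"
  by (simp add: emeasure_unit_interval)

interpretation unit_interval: finite_measure unit_interval_measure
  by standard (simp add: space_unit_interval emeasure_space_unit_interval)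

interpretation unit_cube: product_sigma_finite "\<lambda>_::'v. unit_interval_measure"
  by standard

lemma emeasure_cube_box:
  assumes "finite V" "\<And>v. v \<in> V \<Longrightarrow> X v \<in> sets unit_interval_measure"
  shows "emeasure (\<Pi>\<^sub>M w\<in>V. unit_interval_measure) (\<Pi>\<^sub>E v\<in>V. X v) =
    (\<Prod>v\<in>V. emeasure unit_interval_measure (X v))"
  using assms by (rule unit_cube.emeasure_PiM)

lemma space_cube: "space (\<Pi>\<^sub>M w\<in>V. unit_interval_measure) = V \<rightarrow>\<^sub>E {0..1}"
  by (simp add: space_PiM space_unit_interval)

lemma finite_measure_cube:
  assumes "finite V"
  shows "finite_measure (unit_cube_measure V)"
proof
  show "emeasure (unit_cube_measure V) (space (unit_cube_measure V)) \<noteq> \<infinity>"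
    using emeasure_cube_box[OF assms, of "\<lambda>_. {0..1}"] sets.top[of unit_interval_measure]
      sets.top[of "\<Pi>\<^sub>M w\<in>V. unit_interval_measure"]
    by (simp add: unit_cube_measure_def space_cube space_unit_interval emeasure_space_unit_interval)
qed

lemma unit_interval_measurable_borel [measurable]: "(\<lambda>x. x) \<in> unit_interval_measure \<rightarrow>\<^sub>M borel"
  by (rule measurable_restrict_space1) auto

lemma coordinate_measurable:
  "v \<in> V \<Longrightarrow> (\<lambda>z. z v) \<in> (\<Pi>\<^sub>M w\<in>V. unit_interval_measure) \<rightarrow>\<^sub>M borel"
  by (rule measurable_compose[OF _ unit_interval_measurable_borel]) simp

lemma coordinates_measurable:
  assumes "u \<in> V" "v \<in> V"
  shows "(\<lambda>z. (z u, z v)) \<in> (\<Pi>\<^sub>M w\<in>V. unit_interval_measure) \<rightarrow>\<^sub>M (borel :: (real \<times> real) measure)"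
  by (intro borel_measurable_Pair coordinate_measurable assms)

text \<open>Checked on rectangles: the preimage is a box whose remaining sides are the full
  interval, of measure 1. Distinctness of \<open>u\<close> and \<open>v\<close> keeps the two
  constraints on separate coordinates.\<close>

lemma distr_coordinates:
  assumes V: "finite V" "u \<in> V" "v \<in> V" "u \<noteq> v"
  shows "distr (\<Pi>\<^sub>M w\<in>V. unit_interval_measure) (unit_interval_measure \<Otimes>\<^sub>M unit_interval_measure)
      (\<lambda>z. (z u, z v)) = unit_interval_measure \<Otimes>\<^sub>M unit_interval_measure"
proof (rule pair_measure_eqI[symmetric])
  fix X Y assume XY: "X \<in> sets unit_interval_measure" "Y \<in> sets unit_interval_measure"
  then have sub: "X \<subseteq> {0..1}" "Y \<subseteq> {0..1}"
    using sets.sets_into_space space_unit_interval by blast+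
  let ?Z = "\<lambda>w. if w = u then X else if w = v then Y else {0..1}"
  have top: "{0..1} \<in> sets unit_interval_measure"
    using sets.top[of unit_interval_measure] by (simp add: space_unit_interval)
  have "(\<lambda>z. (z u, z v)) -` (X \<times> Y) \<inter> (V \<rightarrow>\<^sub>E {0..1}) = (\<Pi>\<^sub>E w\<in>V. ?Z w)"
  proof (intro equalityI subsetI)
    fix z assume "z \<in> (\<Pi>\<^sub>E w\<in>V. ?Z w)"
    then have "z \<in> extensional V" "\<And>w. w \<in> V \<Longrightarrow> z w \<in> ?Z w" by (auto simp: PiE_iff)
    moreover from this have "z w \<in> {0..1}" if "w \<in> V" for w
      using that sub by (metis (full_types) subsetD)
    moreover have "z u \<in> X" "z v \<in> Y"
      using calculation(2)[of u] calculation(2)[of v] V by auto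
    ultimately show "z \<in> (\<lambda>z. (z u, z v)) -` (X \<times> Y) \<inter> (V \<rightarrow>\<^sub>E {0..1})"
      by (auto simp: PiE_iff)
  qed (use V in \<open>auto simp: PiE_iff\<close>)
  then have "emeasure (distr (\<Pi>\<^sub>M w\<in>V. unit_interval_measure)
      (unit_interval_measure \<Otimes>\<^sub>M unit_interval_measure) (\<lambda>z. (z u, z v))) (X \<times> Y) =
      emeasure (\<Pi>\<^sub>M w\<in>V. unit_interval_measure) (\<Pi>\<^sub>E w\<in>V. ?Z w)"
    using XY V by (subst emeasure_distr) (auto simp: space_cube)
  also have "\<dots> = (\<Prod>w\<in>V. emeasure unit_interval_measure (?Z w))"
    using XY V top by (intro emeasure_cube_box) auto
  also have "\<dots> = emeasure unit_interval_measure X * (emeasure unit_interval_measure Y *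
      (\<Prod>w\<in>V - {u} - {v}. emeasure unit_interval_measure (?Z w)))"
    using V by (simp add: prod.remove[of V u] prod.remove[of "V - {u}" v])
  also have "(\<Prod>w\<in>V - {u} - {v}. emeasure unit_interval_measure (?Z w)) = 1"
    by (intro prod.neutral) (auto simp: emeasure_space_unit_interval)
  finally show "emeasure unit_interval_measure X * emeasure unit_interval_measure Y =
     emeasure (distr (\<Pi>\<^sub>M w\<in>V. unit_interval_measure)
      (unit_interval_measure \<Otimes>\<^sub>M unit_interval_measure) (\<lambda>z. (z u, z v))) (X \<times> Y)"
    by simp
qed (auto intro: unit_interval.sigma_finite_measure_axioms)

text \<open>Null sets of the square can thus be ignored in the integrand, since two distinct
  coordinates are jointly uniform on the square by \<open>distr_coordinates\<close>.\<close>

lemma AE_coordinates_not_negligible: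
  assumes V: "finite V" "u \<in> V" "v \<in> V" "u \<noteq> v" and N: "negligible N"
  shows "AE z in (\<Pi>\<^sub>M w\<in>V. unit_interval_measure). (z u, z v) \<notin> (N :: (real \<times> real) set)"
proof -
  have "N \<in> null_sets (completion lborel)"
    using N by (simp add: negligible_iff_null_sets)
  \<comment> \<open>A Borel null set containing \<open>N\<close>, so that measurability in the
    uncompleted product is available.\<close>
  then obtain N' where N': "N' \<in> null_sets lborel" "N \<subseteq> N'"
    by (auto simp: null_sets_completion_iff2)
  have "AE p in lborel \<Otimes>\<^sub>M lborel. p \<notin> N'"
    unfolding lborel_prod using N'(1) by (rule AE_not_in)
  then have ae_lborel: "AE x in lborel. AE y in lborel. (x, y) \<notin> N'"
    by (rule lborel_pair.AE_pair)
  have restrict: "AE x in unit_interval_measure. Q x" if "AE x in lborel. Q x" for Q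
  proof -
    have "AE x in lborel. x \<in> {0..1} \<longrightarrow> Q x"
      using that by (rule eventually_mono) simp
    then show ?thesis by (subst AE_restrict_space_iff) auto
  qed
  have ae: "AE x in unit_interval_measure. AE y in unit_interval_measure. (x, y) \<notin> N'"
    by (rule restrict, rule eventually_mono[OF ae_lborel restrict])
  interpret pair_sigma_finite unit_interval_measure unit_interval_measure ..
  have id: "(\<lambda>p. p) \<in> unit_interval_measure \<Otimes>\<^sub>M unit_interval_measure \<rightarrow>\<^sub>M (borel :: (real \<times> real) measure)"
    using borel_measurable_Pair[OF measurable_compose[OF measurable_fst unit_interval_measurable_borel]
        measurable_compose[OF measurable_snd unit_interval_measurable_borel]]
    by simp
  have "- N' \<in> sets borel" using N'(1) by auto
  from measurable_sets[OF id this]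
  have meas: "{p \<in> space (unit_interval_measure \<Otimes>\<^sub>M unit_interval_measure). p \<notin> N'}
      \<in> sets (unit_interval_measure \<Otimes>\<^sub>M unit_interval_measure)"
    by (simp add: vimage_def Int_def conj_commute)
  have "AE p in unit_interval_measure \<Otimes>\<^sub>M unit_interval_measure. p \<notin> N'"
    by (rule AE_pair_measure[OF meas ae])
  then have ae_distr: "AE p in distr (\<Pi>\<^sub>M w\<in>V. unit_interval_measure)
      (unit_interval_measure \<Otimes>\<^sub>M unit_interval_measure) (\<lambda>z. (z u, z v)). p \<notin> N'"
    by (simp only: distr_coordinates[OF V])
  have "(\<lambda>z. (z u, z v)) \<in> (\<Pi>\<^sub>M w\<in>V. unit_interval_measure) \<rightarrow>\<^sub>M
      unit_interval_measure \<Otimes>\<^sub>M unit_interval_measure"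
    by (intro measurable_Pair measurable_component_singleton V)
  from AE_distrD[OF this ae_distr]
  have "AE z in (\<Pi>\<^sub>M w\<in>V. unit_interval_measure). (z u, z v) \<notin> N'" .
  then show ?thesis
    by (rule eventually_mono) (use N'(2) in blast)
qed

section \<open>Limits of homomorphism integrals\<close>

definition edge_product ::
  "('v \<times> 'v) set \<Rightarrow> ('v \<times> 'v \<Rightarrow> nat) \<Rightarrow> (real \<times> real \<Rightarrow> complex) \<Rightarrow> ('v \<Rightarrow> real) \<Rightarrow> complex" where
  "edge_product E \<gamma> f z = (\<Prod>e\<in>E. conj_unless (\<gamma> e) (f (z (fst e), z (snd e))))"

lemma hom_integral_eq: "hom_integral A B E \<gamma> f = (LINT z|unit_cube_measure (A \<union> B). edge_product E \<gamma> f z)"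
  by (simp add: hom_integral_def edge_product_def conj_unless_def case_prod_unfold)

lemma edge_product_measurable:
  assumes "E \<subseteq> V \<times> V" and [measurable]: "f \<in> borel_measurable borel"
  shows "edge_product E \<gamma> f \<in> borel_measurable (\<Pi>\<^sub>M w\<in>V. unit_interval_measure)"
  unfolding edge_product_def[abs_def] conj_unless_def
proof (intro borel_measurable_prod borel_measurable_times borel_measurable_power)
  fix e assume "e \<in> E"
  then have "fst e \<in> V" "snd e \<in> V" using assms(1) by auto
  then show *: "(\<lambda>z. f (z (fst e), z (snd e))) \<in> borel_measurable (\<Pi>\<^sub>M w\<in>V. unit_interval_measure)"
    by (rule measurable_compose[OF coordinates_measurable]) (rule assms(2))
  then show "(\<lambda>z. cnj (f (z (fst e), z (snd e)))) \<in> borel_measurable (\<Pi>\<^sub>M w\<in>V. unit_interval_measure)"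
    by (rule measurable_compose) (intro borel_measurable_continuous_onI continuous_intros)
qed

text \<open>Preimages under \<open>g\<close> and \<open>f\<close> differ by a null set, and the
  completion contains every set that agrees almost everywhere with a measurable one.\<close>

lemma completion_measurable_AE_eq:
  assumes f: "f \<in> measurable M borel" and eq: "AE x in M. f x = g x"
  shows "g \<in> measurable (completion M) borel"
proof (rule measurableI)
  fix S :: "'b set" assume S: "S \<in> sets borel"
  show "g -` S \<inter> space (completion M) \<in> sets (completion M)"
  proof (rule completion.in_sets_AE)
    show "AE x in completion M. x \<in> f -` S \<inter> space M \<longleftrightarrow> x \<in> g -` S \<inter> space (completion M)"
      using AE_completion[OF eq] by eventually_elim auto
    show "f -` S \<inter> space M \<in> sets (completion M)"
      using measurable_sets[OF f S] by auto
  qed auto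
qed auto

text \<open>Bounded convergence. It is applied twice, from step functions to continuous ones and
  from these to bounded measurable ones; measurability of the limiting integrand comes from the
  approximants.\<close>

lemma hom_integral_limit:
  assumes G: "bipartite_graph A B E" and N: "negligible N"
    and meas: "\<And>m. g m \<in> borel_measurable borel"
    and bound: "\<And>m p. p \<in> unit_square \<Longrightarrow> cmod (g m p) \<le> C"
    and lim: "\<And>p. p \<in> unit_square \<Longrightarrow> p \<notin> N \<Longrightarrow> (\<lambda>m. g m p) \<longlonglongrightarrow> f p"
  shows "(\<lambda>m. hom_integral A B E \<gamma> (g m)) \<longlonglongrightarrow> hom_integral A B E \<gamma> f"
proof -
  define V where "V = A \<union> B"
  let ?M = "\<Pi>\<^sub>M w\<in>V. unit_interval_measure"
  have fin: "finite V" and sub: "E \<subseteq> V \<times> V"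
    using G by (auto simp: bipartite_graph_def V_def)
  \<comment> \<open>The sides are disjoint, so each edge reads two different coordinates.\<close>
  have ne: "fst e \<noteq> snd e" if "e \<in> E" for e
  proof -
    have "fst e \<in> A" "snd e \<in> B" "A \<inter> B = {}"
      using G that by (auto simp: bipartite_graph_def)
    then show ?thesis by auto
  qed
  have finE: "finite E" using fin sub by (meson finite_SigmaI finite_subset)
  have "AE z in ?M. \<forall>e\<in>E. (z (fst e), z (snd e)) \<notin> N"
    using fin sub ne by (intro AE_finite_allI finE AE_coordinates_not_negligible N) auto
  then have "AE z in ?M. \<forall>e\<in>E. (z (fst e), z (snd e)) \<in> unit_square - N"
    using AE_space
  proof eventually_elim
    case (elim z)
    have "z (fst e) \<in> {0..1}" "z (snd e) \<in> {0..1}" if "e \<in> E" for e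
      using elim(2) sub that unfolding space_cube by (auto simp: PiE_iff)
    then show ?case using elim(1) by (auto simp del: atLeastAtMost_iff)
  qed
  then have conv: "AE z in ?M. (\<lambda>m. edge_product E \<gamma> (g m) z) \<longlonglongrightarrow> edge_product E \<gamma> f z"
  proof eventually_elim
    case (elim z)
    then show ?case
      unfolding edge_product_def conj_unless_def by (intro tendsto_intros lim) auto
  qed
  have [measurable]: "edge_product E \<gamma> (g m) \<in> borel_measurable ?M" for m
    by (rule edge_product_measurable[OF sub meas])
  interpret cube: finite_measure "unit_cube_measure V"
    by (rule finite_measure_cube[OF fin])
  show ?thesis
    unfolding hom_integral_eq V_def[symmetric]
  proof (rule integral_dominated_convergence[where w = "\<lambda>_. \<Prod>e\<in>E. C ^ \<gamma> e * C ^ (1 - \<gamma> e)"])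
    show "edge_product E \<gamma> (g m) \<in> borel_measurable (unit_cube_measure V)" for m
      unfolding unit_cube_measure_def by (intro measurable_completion) measurable
    show "edge_product E \<gamma> f \<in> borel_measurable (unit_cube_measure V)"
      unfolding unit_cube_measure_def
    proof (rule completion_measurable_AE_eq)
      \<comment> \<open>The pointwise \<open>lim\<close> is measurable for the product
        sigma-algebra, whereas the integrand of \<open>f\<close> is only known to equal it almost
        everywhere; this is where the completed measure matters.\<close>
      show "(\<lambda>z. lim (\<lambda>m. edge_product E \<gamma> (g m) z)) \<in> borel_measurable ?M"
        by (intro borel_measurable_lim_metric) measurable
      show "AE z in ?M. lim (\<lambda>m. edge_product E \<gamma> (g m) z) = edge_product E \<gamma> f z"
        using conv by eventually_elim (rule limI)
    qed
    show "integrable (unit_cube_measure V) (\<lambda>_. \<Prod>e\<in>E. C ^ \<gamma> e * C ^ (1 - \<gamma> e))"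
      by simp
    show "AE z in unit_cube_measure V. (\<lambda>m. edge_product E \<gamma> (g m) z) \<longlonglongrightarrow> edge_product E \<gamma> f z"
      unfolding unit_cube_measure_def by (rule AE_completion[OF conv])
    show "AE z in unit_cube_measure V.
        norm (edge_product E \<gamma> (g m) z) \<le> (\<Prod>e\<in>E. C ^ \<gamma> e * C ^ (1 - \<gamma> e))" for m
    proof (rule AE_I2)
      fix z assume "z \<in> space (unit_cube_measure V)"
      then have z: "z \<in> V \<rightarrow>\<^sub>E {0..1}" by (simp add: unit_cube_measure_def space_cube)
      show "norm (edge_product E \<gamma> (g m) z) \<le> (\<Prod>e\<in>E. C ^ \<gamma> e * C ^ (1 - \<gamma> e))"
        unfolding edge_product_def prod_norm[symmetric]
      proof (intro prod_mono conjI norm_ge_zero)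
        fix e assume "e \<in> E"
        then have "fst e \<in> V" "snd e \<in> V" using sub by auto
        then have "cmod (g m (z (fst e), z (snd e))) \<le> C"
          using z by (intro bound) (auto simp: PiE_iff)
        then show "cmod (conj_unless (\<gamma> e) (g m (z (fst e), z (snd e)))) \<le> C ^ \<gamma> e * C ^ (1 - \<gamma> e)"
          unfolding conj_unless_def norm_mult norm_power complex_mod_cnj
          by (intro mult_mono power_mono zero_le_power) (auto intro: order_trans[OF norm_ge_zero])
      qed
    qed
  qed
qed

section \<open>Step functions on a uniform grid\<close>

definition cell :: "nat \<Rightarrow> real \<Rightarrow> nat" where
  "cell n x = min (n - 1) (nat \<lfloor>real n * x\<rfloor>)"

definition step_function :: "nat \<Rightarrow> (nat \<Rightarrow> nat \<Rightarrow> complex) \<Rightarrow> real \<times> real \<Rightarrow> complex" where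
  "step_function n M p = M (cell n (fst p)) (cell n (snd p))"

lemma cell_less: "0 < n \<Longrightarrow> cell n x < n"
  by (auto simp: cell_def)

lemma cell_measurable [measurable]: "cell n \<in> borel \<rightarrow>\<^sub>M count_space UNIV"
  unfolding cell_def[abs_def] by measurable

lemma step_function_measurable [measurable]: "step_function n M \<in> borel_measurable borel"
  unfolding step_function_def[abs_def] borel_prod[symmetric] by measurable

lemma cell_eq:
  assumes "real i / real n < x" "x < (real i + 1) / real n" "i < n"
  shows "cell n x = i"
proof -
  have "\<lfloor>real n * x\<rfloor> = int i"
    using assms by (intro floor_unique) (auto simp: field_simps)
  then show ?thesis using assms(3) by (simp add: cell_def)
qed

text \<open>The second inequality is not strict because the minimum in \<open>cell\<close> puts
  \<open>x = 1\<close> into the last cell.\<close>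

lemma cell_bounds:
  assumes n: "0 < n" and x: "x \<in> {0..1}"
  shows "real (cell n x) \<le> real n * x" "real n * x \<le> real (cell n x) + 1"
proof -
  have nx: "0 \<le> real n * x" "real n * x \<le> real n" using x by (auto simp: mult_left_le)
  have fl: "real (nat \<lfloor>real n * x\<rfloor>) = of_int \<lfloor>real n * x\<rfloor>" using nx by simp
  have "real (cell n x) \<le> real n * x \<and> real n * x \<le> real (cell n x) + 1"
  proof (cases "nat \<lfloor>real n * x\<rfloor> \<le> n - 1")
    case True
    then have "real (cell n x) = of_int \<lfloor>real n * x\<rfloor>" unfolding cell_def using fl by simp
    then show ?thesis by linarith
  next
    case False
    then have "real (cell n x) = real n - 1" unfolding cell_def using n by (simp add: of_nat_diff)
    moreover have "real n \<le> real (nat \<lfloor>real n * x\<rfloor>)" using False by linarith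
    ultimately show ?thesis using fl nx by linarith
  qed
  then show "real (cell n x) \<le> real n * x" "real n * x \<le> real (cell n x) + 1" by auto
qed

lemma cell_approx:
  assumes n: "0 < n" and x: "x \<in> {0..1}"
  shows "\<bar>real (cell n x) / real n - x\<bar> \<le> 1 / real n"
proof -
  have "\<bar>real (cell n x) - real n * x\<bar> \<le> 1"
    using cell_bounds[OF n x] by linarith
  moreover have "real (cell n x) / real n - x = (real (cell n x) - real n * x) / real n"
    using n by (simp add: field_simps)
  ultimately show ?thesis
    using n by (simp add: abs_divide divide_right_mono)
qed

text \<open>The cell contains an open interval of length \<open>1 / n\<close> and lies in its
  closure, so the treatment of endpoints does not affect the measure.\<close>

lemma emeasure_cell:
  assumes i: "i < n"
  shows "emeasure unit_interval_measure {x \<in> {0..1}. cell n x = i} = ennreal (1 / real n)"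
proof -
  let ?X = "{x \<in> {0..1}. cell n x = i}" and ?a = "real i / real n" and ?b = "(real i + 1) / real n"
  have n: "0 < n" using i by auto
  have borel: "?X \<in> sets borel" by measurable
  have ab: "?b - ?a = 1 / real n" "?a \<le> ?b" by (auto simp: field_simps divide_right_mono simp flip: diff_divide_distrib)
  have "real i + 1 \<le> real n" using i by linarith
  then have b1: "?b \<le> 1" using n by (simp add: field_simps)
  have sub1: "{?a<..<?b} \<subseteq> ?X"
  proof
    fix x assume x: "x \<in> {?a<..<?b}"
    have "0 \<le> ?a" by simp
    then have "0 \<le> x" "x \<le> 1" using x b1 unfolding greaterThanLessThan_iff by linarith+
    then show "x \<in> ?X" using x cell_eq[of i n x] i by auto
  qed
  have sub2: "?X \<subseteq> {?a..?b}"
  proof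
    fix x assume "x \<in> ?X"
    then have "real i \<le> real n * x \<and> real n * x \<le> real i + 1"
      using cell_bounds[OF n, of x] by auto
    then show "x \<in> {?a..?b}" using n by (auto simp: field_simps)
  qed
  have "emeasure lborel ?X = ennreal (1 / real n)"
  proof (rule antisym)
    show "emeasure lborel ?X \<le> ennreal (1 / real n)"
      using emeasure_mono[OF sub2, of lborel] ab by simp
    show "ennreal (1 / real n) \<le> emeasure lborel ?X"
      using emeasure_mono[OF sub1, of lborel] borel ab by simp
  qed
  then show ?thesis
    using borel by (subst emeasure_unit_interval) auto
qed

text \<open>The integrand is constant on each box \<open>Q k\<close>, a product of cells with
  measure \<open>(1 / n) ^ card V\<close>, and the maps \<open>k\<close> are precisely the index
  choices in \<open>hom_sum\<close>.\<close>

lemma hom_integral_step_function: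
  assumes G: "bipartite_graph A B E" and n: "0 < n"
  shows "hom_integral A B E \<gamma> (step_function n M) =
    hom_sum (A \<union> B) E n (\<lambda>e i j. conj_unless (\<gamma> e) (M i j)) / of_nat (n ^ card (A \<union> B))"
proof -
  define V where "V = A \<union> B"
  let ?M = "\<Pi>\<^sub>M w\<in>V. unit_interval_measure"
  have fin: "finite V" and sub: "E \<subseteq> V \<times> V"
    using G by (auto simp: bipartite_graph_def V_def)
  define Q where "Q k = (\<Pi>\<^sub>E v\<in>V. {x \<in> {0..1}. cell n x = k v})" for k
  define val where "val k = (\<Prod>e\<in>E. conj_unless (\<gamma> e) (M (k (fst e)) (k (snd e))))" for k
  have cell_sets: "{x \<in> {0..1}. cell n x = i} \<in> sets unit_interval_measure" for i
    by (auto simp: sets_restrict_space_iff)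
  have Q_sets: "Q k \<in> sets ?M" for k
    unfolding Q_def using fin cell_sets by (intro sets_PiM_I_finite) auto
  have Q_emeasure: "emeasure ?M (Q k) = ennreal ((1 / real n) ^ card V)" if "k \<in> V \<rightarrow>\<^sub>E {..<n}" for k
  proof -
    have "emeasure ?M (Q k) = (\<Prod>v\<in>V. emeasure unit_interval_measure {x \<in> {0..1}. cell n x = k v})"
      unfolding Q_def by (intro emeasure_cube_box fin cell_sets)
    also have "\<dots> = (\<Prod>v\<in>V. ennreal (1 / real n))"
      using that by (intro prod.cong refl emeasure_cell) (auto simp: PiE_iff)
    finally show ?thesis by (simp add: ennreal_power)
  qed
  have sum_eq: "edge_product E \<gamma> (step_function n M) z = (\<Sum>k\<in>V \<rightarrow>\<^sub>E {..<n}. indicator (Q k) z *\<^sub>R val k)"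
    if z: "z \<in> space ?M" for z
  proof -
    define c where "c = (\<lambda>v\<in>V. cell n (z v))"
    have c: "c \<in> V \<rightarrow>\<^sub>E {..<n}" by (auto simp: c_def cell_less n)
    \<comment> \<open>The boxes partition the cube: only the map of cell indices of \<open>z\<close>
      gives a box containing \<open>z\<close>.\<close>
    have mem: "z \<in> Q k \<longleftrightarrow> k = c" if "k \<in> V \<rightarrow>\<^sub>E {..<n}" for k
      using z that unfolding space_cube by (auto simp: Q_def c_def PiE_iff extensional_def fun_eq_iff)
    have "(\<Sum>k\<in>V \<rightarrow>\<^sub>E {..<n}. indicator (Q k) z *\<^sub>R val k) = (\<Sum>k\<in>V \<rightarrow>\<^sub>E {..<n}. if k = c then val k else 0)"
      by (intro sum.cong refl) (auto simp: mem)
    also have "\<dots> = val c"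
      using c fin by (simp add: finite_PiE)
    also have "\<dots> = edge_product E \<gamma> (step_function n M) z"
      unfolding val_def edge_product_def step_function_def
    proof (intro prod.cong refl)
      fix e assume "e \<in> E"
      then have "fst e \<in> V" "snd e \<in> V" using sub by auto
      then show "conj_unless (\<gamma> e) (M (c (fst e)) (c (snd e))) =
        conj_unless (\<gamma> e) (M (cell n (fst (z (fst e), z (snd e)))) (cell n (snd (z (fst e), z (snd e)))))"
        by (simp add: c_def)
    qed
    finally show ?thesis ..
  qed
  \<comment> \<open>The integrand is already product measurable, so completing the measure does not
    change its integral.\<close>
  have "hom_integral A B E \<gamma> (step_function n M) = (LINT z|?M. edge_product E \<gamma> (step_function n M) z)"
    unfolding hom_integral_eq unit_cube_measure_def V_def[symmetric]
    by (intro integral_completion edge_product_measurable[OF sub]) measurable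
  also have "\<dots> = (LINT z|?M. (\<Sum>k\<in>V \<rightarrow>\<^sub>E {..<n}. indicator (Q k) z *\<^sub>R val k))"
    by (intro Bochner_Integration.integral_cong sum_eq) auto
  also have "\<dots> = (\<Sum>k\<in>V \<rightarrow>\<^sub>E {..<n}. LINT z|?M. indicator (Q k) z *\<^sub>R val k)"
    using Q_sets Q_emeasure by (intro Bochner_Integration.integral_sum integrable_scaleR_left) auto
  also have "\<dots> = (\<Sum>k\<in>V \<rightarrow>\<^sub>E {..<n}. (1 / real n) ^ card V *\<^sub>R val k)"
  proof (intro sum.cong refl)
    fix k assume k: "k \<in> V \<rightarrow>\<^sub>E {..<n}"
    then show "(LINT z|?M. indicator (Q k) z *\<^sub>R val k) = (1 / real n) ^ card V *\<^sub>R val k"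
      using Q_sets[of k] Q_emeasure[OF k] sets.sets_into_space[OF Q_sets[of k]]
      by (simp add: measure_def Int_absorb2)
  qed
  also have "\<dots> = hom_sum V E n (\<lambda>e i j. conj_unless (\<gamma> e) (M i j)) / of_nat (n ^ card V)"
    by (simp add: hom_sum_def val_def scaleR_conv_of_real sum_divide_distrib power_divide)
  finally show ?thesis unfolding V_def .
qed

lemma step_function_bounded_measurable:
  assumes "0 < n"
  shows "step_function n M \<in> bounded_measurable"
proof -
  have "step_function n M \<in> borel_measurable lebesgue"
    by (intro measurable_completion) (simp add: step_function_measurable)
  then have "step_function n M \<in> borel_measurable (lebesgue_on unit_square)"
    by (rule measurable_restrict_space1)
  moreover have "step_function n M ` unit_square \<subseteq> (\<lambda>(i, j). M i j) ` ({..<n} \<times> {..<n})"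
    using cell_less[OF assms] by (auto simp: step_function_def)
  then have "bounded (step_function n M ` unit_square)"
    by (meson finite_SigmaI finite_imageI finite_imp_bounded finite_lessThan finite_subset)
  ultimately show ?thesis by (simp add: bounded_measurable_def)
qed

text \<open>The value \<open>M i j\<close> is taken on a nonempty open rectangle inside the square,
  and such a set is not negligible.\<close>

lemma step_function_AE_0:
  assumes ae: "AE p in lebesgue_on unit_square. step_function n M p = 0" and ij: "i < n" "j < n"
  shows "M i j = 0"
proof (rule ccontr)
  assume nz: "M i j \<noteq> 0"
  define I where "I k = {real k / real n<..<(real k + 1) / real n}" for k
  have I01: "I k \<subseteq> {0..1}" if "k < n" for k
  proof
    fix x assume x: "x \<in> I k"
    have "real k + 1 \<le> real n" using that by linarith
    then have "(real k + 1) / real n \<le> 1" using that by (simp add: field_simps)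
    moreover have "0 \<le> real k / real n" by simp
    ultimately show "x \<in> {0..1}"
      using x unfolding I_def greaterThanLessThan_iff atLeastAtMost_iff by linarith
  qed
  have I_ne: "I k \<noteq> {}" if "k < n" for k
    using that by (simp add: I_def divide_strict_right_mono not_le)
  have "compact unit_square" by (intro compact_Times) auto
  then have "unit_square \<in> lmeasurable" by (rule lmeasurable_compact)
  then have "unit_square \<inter> space lebesgue \<in> sets lebesgue"
    by (simp add: fmeasurableD)
  from iffD1[OF AE_restrict_space_iff[OF this] ae]
  have "AE p in lebesgue. p \<in> unit_square \<longrightarrow> step_function n M p = 0" .
  then have "AE p in lebesgue. p \<notin> I i \<times> I j"
  proof eventually_elim
    case (elim p)
    show ?case
    proof
      assume p: "p \<in> I i \<times> I j"
      then have "p \<in> unit_square" using I01[OF ij(1)] I01[OF ij(2)] by blast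
      moreover have "step_function n M p = M i j"
        using p ij cell_eq[of i n "fst p"] cell_eq[of j n "snd p"] by (auto simp: step_function_def I_def)
      ultimately show False using elim nz by metis
    qed
  qed
  then have "negligible (I i \<times> I j)"
    by (simp add: negligible_iff_null_sets completion.AE_iff_null_sets)
  moreover have "open (I i \<times> I j)" by (auto simp: I_def intro: open_Times)
  ultimately show False
    using open_not_negligible[of "I i \<times> I j"] I_ne ij by auto
qed

text \<open>The value on a cell is sampled at its lower left corner, which is within
  \<open>1 / Suc m\<close> of \<open>p\<close> in each coordinate; \<open>Suc m\<close> keeps the
  grid nonempty.\<close>

lemma continuous_step_approx:
  assumes g: "continuous_on UNIV g" and p: "p \<in> unit_square"
  shows "(\<lambda>m. step_function (Suc m) (\<lambda>i j. g (real i / real (Suc m), real j / real (Suc m))) p) \<longlonglongrightarrow> g p"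
proof -
  have *: "(\<lambda>m. real (cell (Suc m) x) / real (Suc m)) \<longlonglongrightarrow> x" if "x \<in> {0..1}" for x
  proof (rule LIM_zero_cancel, rule Lim_null_comparison)
    show "\<forall>\<^sub>F m in sequentially. norm (real (cell (Suc m) x) / real (Suc m) - x) \<le> inverse (real (Suc m))"
      unfolding inverse_eq_divide real_norm_def
      by (intro always_eventually allI cell_approx that) simp
  qed (rule LIMSEQ_inverse_real_of_nat)
  have "(\<lambda>m. (real (cell (Suc m) (fst p)) / real (Suc m), real (cell (Suc m) (snd p)) / real (Suc m)))
      \<longlonglongrightarrow> (fst p, snd p)"
    using p by (intro tendsto_Pair *) auto
  from continuous_on_tendsto_compose[OF g this] show ?thesis
    by (simp add: step_function_def)
qed

text \<open>On a step function the seminorm is the root of the modulus of the matrix sum divided by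
  a constant depending only on the size, which cancels in the triangle inequality. Definiteness
  transfers through \<open>step_function_AE_0\<close>.\<close>

lemma norming_sum_of_complex_norming:
  assumes G: "bipartite_graph A B E" and col: "edge_2colouring E \<alpha>" and norming: "complex_norming A B E \<alpha>"
  shows "norming_sum (A \<union> B) E \<alpha>"
proof
  let ?V = "A \<union> B"
  let ?T = "\<lambda>n F. hom_sum ?V E n (\<lambda>e i j. conj_unless (\<alpha> e) (F i j))"
  define N where "N f = cmod (hom_integral A B E \<alpha> f) powr (1 / real (card E))" for f
  have *: "seminorm_on_bounded_measurable N \<and>
      (\<forall>f\<in>bounded_measurable. N f = 0 \<longrightarrow> (AE p in lebesgue_on unit_square. f p = 0))"
    using norming unfolding complex_norming_def Let_def N_def[abs_def] .
  note seminorm = conjunct1[OF *] and definite = conjunct2[OF *, rule_format]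
  note subadditive = conjunct2[OF conjunct2[OF seminorm[unfolded seminorm_on_bounded_measurable_def]], rule_format]
  show fin: "finite ?V" and sub: "E \<subseteq> ?V \<times> ?V"
    using G by (auto simp: bipartite_graph_def)
  show "edge_2colouring E \<alpha>" by (rule col)
  show "E \<noteq> {}"
  proof
    assume "E = {}"
    \<comment> \<open>There is a vertex, and no vertex is isolated.\<close>
    with G show False by (auto simp: bipartite_graph_def)
  qed
  show "finite E"
    using fin sub by (meson finite_SigmaI finite_subset)
  have N_step: "N (step_function n F) =
      cmod (?T n F) powr (1 / real (card E)) / real (n ^ card ?V) powr (1 / real (card E))"
    if "0 < n" for n F
  proof -
    have "cmod (hom_integral A B E \<alpha> (step_function n F)) = cmod (?T n F) / real (n ^ card ?V)"
      unfolding hom_integral_step_function[OF G that] norm_divide norm_of_nat ..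
    then show ?thesis unfolding N_def by (simp only: powr_divide norm_ge_zero of_nat_0_le_iff)
  qed
  show "cmod (?T n (\<lambda>i j. F i j + H i j)) powr (1 / real (card E)) \<le>
      cmod (?T n F) powr (1 / real (card E)) + cmod (?T n H) powr (1 / real (card E))"
    if n: "0 < n" for n F H
  proof -
    let ?d = "real (n ^ card ?V) powr (1 / real (card E))"
    have sum: "step_function n (\<lambda>i j. F i j + H i j) = (\<lambda>p. step_function n F p + step_function n H p)"
      by (simp add: step_function_def fun_eq_iff)
    have "N (step_function n (\<lambda>i j. F i j + H i j)) \<le> N (step_function n F) + N (step_function n H)"
      unfolding sum by (intro subadditive step_function_bounded_measurable n)
    then have le: "cmod (?T n (\<lambda>i j. F i j + H i j)) powr (1 / real (card E)) / ?d
      \<le> (cmod (?T n F) powr (1 / real (card E)) + cmod (?T n H) powr (1 / real (card E))) / ?d"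
      unfolding N_step[OF n] add_divide_distrib .
    have pos: "0 < ?d"
      using n by simp
    have cancel: "a \<le> b" if "a / d \<le> b / d" "0 < d" for a b d :: real
      using that by (simp add: divide_le_cancel)
    show ?thesis
      by (rule cancel[OF le pos])
  qed
  show "F i j = 0" if "0 < n" "?T n F = 0" "i < n" "j < n" for n F i j
  proof -
    have "N (step_function n F) = 0"
      unfolding N_step[OF that(1)] that(2) by simp
    with step_function_bounded_measurable[OF that(1)]
    have "AE p in lebesgue_on unit_square. step_function n F p = 0" by (rule definite)
    then show ?thesis using that(3,4) by (rule step_function_AE_0)
  qed
qed

section \<open>Passage to all bounded measurable functions\<close>

lemma real_dominates_limit:
  assumes "a \<longlonglongrightarrow> a'" "b \<longlonglongrightarrow> b'" and "\<And>m::nat. a m \<in> \<real> \<and> cmod (b m) \<le> Re (a m)"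
  shows "a' \<in> \<real> \<and> cmod b' \<le> Re a'"
proof
  show "a' \<in> \<real>"
    by (rule closed_sequentially[OF closed_complex_Reals _ assms(1)]) (simp add: assms(3))
  show "cmod b' \<le> Re a'"
    by (rule LIMSEQ_le[OF tendsto_norm[OF assms(2)] tendsto_Re[OF assms(1)]]) (simp add: assms(3))
qed

theorem theorem4p15:
  fixes A B :: "'v set" and E :: "('v \<times> 'v) set"
    and \<alpha> \<beta> :: "'v \<times> 'v \<Rightarrow> nat" and f :: "real \<times> real \<Rightarrow> complex"
  assumes "bipartite_graph A B E"
    and "edge_2colouring E \<alpha>"
    and "complex_norming A B E \<alpha>"
    and "edge_2colouring E \<beta>"
    and "f \<in> bounded_measurable"
  shows "hom_integral A B E \<alpha> f \<in> \<real> \<and>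
    cmod (hom_integral A B E \<beta> f) \<le> Re (hom_integral A B E \<alpha> f)"
proof -
  note limit = hom_integral_limit[OF assms(1)]
  interpret norming_sum "A \<union> B" E \<alpha> "\<lambda>n F. hom_sum (A \<union> B) E n (\<lambda>e i j. conj_unless (\<alpha> e) (F i j))"
    using norming_sum_of_complex_norming[OF assms(1-3)] by simp_all
  let ?P = "\<lambda>f. hom_integral A B E \<alpha> f \<in> \<real> \<and> cmod (hom_integral A B E \<beta> f) \<le> Re (hom_integral A B E \<alpha> f)"
  have step: "?P (step_function n M)" if n: "0 < n" for n M
  proof -
    obtain x where x: "0 \<le> x" "hom_sum (A \<union> B) E n (\<lambda>e i j. conj_unless (\<alpha> e) (M i j)) = of_real x"
      using T_nonneg[OF n] by blast
    have "hom_integral A B E \<alpha> (step_function n M) = of_real (x / real (n ^ card (A \<union> B)))"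
      using x by (simp add: hom_integral_step_function[OF assms(1) n])
    moreover have "cmod (hom_integral A B E \<beta> (step_function n M)) \<le> x / real (n ^ card (A \<union> B))"
      using recolour_le[OF assms(4) n, of M] x
      by (simp add: hom_integral_step_function[OF assms(1) n] norm_divide norm_power divide_right_mono)
    ultimately show ?thesis by simp
  qed
  have cont: "?P g" if g: "continuous_on UNIV g" and C: "\<And>p. cmod (g p) \<le> C" for g C
  proof -
    let ?s = "\<lambda>m. step_function (Suc m) (\<lambda>i j. g (real i / real (Suc m), real j / real (Suc m)))"
    have "(\<lambda>m. hom_integral A B E \<gamma> (?s m)) \<longlonglongrightarrow> hom_integral A B E \<gamma> g" for \<gamma>
    \<comment> \<open>Convergence holds at every point of the square, so the exceptional set is
      empty.\<close>
    proof (rule limit[of "{}"])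
      show "cmod (?s m p) \<le> C" for m p
        unfolding step_function_def by (rule C)
      show "(\<lambda>m. ?s m p) \<longlonglongrightarrow> g p" if "p \<in> unit_square" for p
        by (rule continuous_step_approx[OF g that])
    qed (auto simp: step_function_measurable)
    from real_dominates_limit[OF this this step] show ?thesis by simp
  qed
  obtain C where C: "0 < C" "\<And>p. p \<in> unit_square \<Longrightarrow> cmod (f p) \<le> C"
    using assms(5) unfolding bounded_measurable_def bounded_pos by auto
  have "compact unit_square" by (intro compact_Times) auto
  then have square: "unit_square \<in> sets lebesgue"
    by (intro fmeasurableD lmeasurable_compact)
  \<comment> \<open>Extension by zero gives a Lebesgue measurable function on the whole plane, to
    which the approximation by continuous functions applies.\<close>
  define F where "F p = (if p \<in> unit_square then f p else 0)" for p
  have "F \<in> borel_measurable lebesgue"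
    using assms(5) square unfolding F_def[abs_def]
    by (subst borel_measurable_if) (auto simp: bounded_measurable_def)
  from lebesgue_measurable_imp_measurable_on[OF this square]
  obtain N g where N: "negligible N" and g: "\<And>m::nat. continuous_on UNIV (g m)"
    and lim: "\<And>p. p \<notin> N \<Longrightarrow> (\<lambda>m. g m p) \<longlonglongrightarrow> (if p \<in> unit_square then F p else 0)"
    unfolding measurable_on_def by blast
  \<comment> \<open>The continuous approximants need not be uniformly bounded. Projection onto the
    closed disc of radius \<open>C\<close> is continuous, forces the bound and fixes the values of
    \<open>f\<close> on the square.\<close>
  let ?c = "closest_point (cball (0::complex) C)"
  have cball: "convex (cball (0::complex) C)" "closed (cball (0::complex) C)" "cball (0::complex) C \<noteq> {}"
    using C(1) by auto
  have cont_c: "continuous_on UNIV ?c"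
    by (rule continuous_on_closest_point[OF cball])
  have bound_c: "cmod (?c z) \<le> C" for z
    using closest_point_in_set[OF cball(2,3), of z] by simp
  have cont_cg: "continuous_on UNIV (\<lambda>p. ?c (g m p))" for m
    by (rule continuous_on_compose2[OF cont_c g]) auto
  have "(\<lambda>m. hom_integral A B E \<gamma> (\<lambda>p. ?c (g m p))) \<longlonglongrightarrow> hom_integral A B E \<gamma> f" for \<gamma>
  proof (rule limit[OF N])
    show "(\<lambda>p. ?c (g m p)) \<in> borel_measurable borel" for m
      by (rule borel_measurable_continuous_onI[OF cont_cg])
    show "cmod (?c (g m p)) \<le> C" for m p by (rule bound_c)
    show "(\<lambda>m. ?c (g m p)) \<longlonglongrightarrow> f p" if p: "p \<in> unit_square" "p \<notin> N" for p
    proof -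
      have "(\<lambda>m. g m p) \<longlonglongrightarrow> f p" using lim[OF p(2)] p(1) by (simp add: F_def)
      from continuous_on_tendsto_compose[OF cont_c this]
      have "(\<lambda>m. ?c (g m p)) \<longlonglongrightarrow> ?c (f p)" by simp
      moreover have "?c (f p) = f p"
        using C(2)[OF p(1)] by (intro closest_point_self) simp
      ultimately show ?thesis by simp
    qed
  qed
  from real_dominates_limit[OF this this cont[OF cont_cg bound_c]] show ?thesis .
qed

end
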